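(* Let $c\ge1$ be a constant and for $n\ge0$ let $S_n=[-\lceil cn\rceil,\lceil cn\rceil]^2$ (grid graph), $\underline{S}=(S_n)_{n\ge0}$. Then there is a sequence of activated vertices $\underline{v}$ such that the burning density exists and $\delta(\underline{S},\underline{v})=1$.
   Context: For an integer $a\ge0$, $[-a,a]^2$ denotes the graph on vertex set $[-a,a]^2\subset\mathbb{Z}^2$ in which two vertices are adjacent iff their $L_1$-distance is $1$. Burning process: let $\underline{G}=(G_0,G_1,\dots)$ be graphs with $G_{n-1}$ an induced subgraph of $G_n$ for all $n\ge1$. A sequence of activated vertices is $\underline{v}=(v_n)_{n\ge0}$ with $v_n\in V(G_n)\cup\{\bullet\}$ ($\bullet$ means no vertex is activated). Burning sets: $B_0=\{v_0\}$ (empty if $v_0=\bullet$), and $B_{n+1}=N_{G_{n+1}}[B_n]$ if $v_{n+1}=\bullet$, and $B_{n+1}=N_{G_{n+1}}[B_n]\cup\{v_{n+1}\}$ otherwise, where $N_G[X]$ is the closed neighbourhood of $X$ in $G$. The burning density is $\delta(\underline{G},\underline{v})=\lim_{n\to\infty}|B_n|/|V(G_n)|$ when the limit exists. *)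

theory Defs
  imports Complex_Main "Graph_Theory.Pair_Digraph" "Graph_Theory.Digraph_Component"
begin

text \<open>Undirected simple graphs are finite, loop-free, symmetric digraphs (locale \<^locale>\<open>pair_graph\<close>).\<close>

definition square_grid :: "int \<Rightarrow> (int \<times> int) pair_pre_digraph" where
  "square_grid a =
    \<lparr> pverts = {-a..a} \<times> {-a..a},
      parcs = {(p, q). p \<in> {-a..a} \<times> {-a..a} \<and> q \<in> {-a..a} \<times> {-a..a}
                \<and> \<bar>fst p - fst q\<bar> + \<bar>snd p - snd q\<bar> = 1} \<rparr>"

definition growing_graphs :: "(nat \<Rightarrow> 'v pair_pre_digraph) \<Rightarrow> bool" where
  "growing_graphs G \<longleftrightarrow>
    (\<forall>n. pair_graph (G n)) \<and> (\<forall>n. induced_subgraph (with_proj (G n)) (with_proj (G (Suc n))))"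

definition closed_nbhd :: "'v pair_pre_digraph \<Rightarrow> 'v set \<Rightarrow> 'v set" where
  "closed_nbhd G X = X \<union> {y. \<exists>x\<in>X. x \<rightarrow>\<^bsub>with_proj G\<^esub> y}"

text \<open>\<^const>\<open>None\<close> stands for the symbol \<open>\<bullet>\<close>: no vertex is activated in that step.\<close>

definition activation_sequence ::
    "(nat \<Rightarrow> 'v pair_pre_digraph) \<Rightarrow> (nat \<Rightarrow> 'v option) \<Rightarrow> bool" where
  "activation_sequence G v \<longleftrightarrow> (\<forall>n x. v n = Some x \<longrightarrow> x \<in> pverts (G n))"

primrec burning_set ::
    "(nat \<Rightarrow> 'v pair_pre_digraph) \<Rightarrow> (nat \<Rightarrow> 'v option) \<Rightarrow> nat \<Rightarrow> 'v set" where
  "burning_set G v 0 = (case v 0 of None \<Rightarrow> {} | Some x \<Rightarrow> {x})"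
| "burning_set G v (Suc n) =
    (case v (Suc n) of
       None \<Rightarrow> closed_nbhd (G (Suc n)) (burning_set G v n)
     | Some x \<Rightarrow> closed_nbhd (G (Suc n)) (burning_set G v n) \<union> {x})"

definition burning_ratio ::
    "(nat \<Rightarrow> 'v pair_pre_digraph) \<Rightarrow> (nat \<Rightarrow> 'v option) \<Rightarrow> nat \<Rightarrow> real" where
  "burning_ratio G v n = real (card (burning_set G v n)) / real (card (pverts (G n)))"

definition burning_density_exists ::
    "(nat \<Rightarrow> 'v pair_pre_digraph) \<Rightarrow> (nat \<Rightarrow> 'v option) \<Rightarrow> bool" where
  "burning_density_exists G v \<longleftrightarrow> convergent (burning_ratio G v)"

text \<open>Only meaningful together with \<^const>\<open>burning_density_exists\<close>.\<close>

definition burning_density ::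
    "(nat \<Rightarrow> 'v pair_pre_digraph) \<Rightarrow> (nat \<Rightarrow> 'v option) \<Rightarrow> real" where
  "burning_density G v = lim (burning_ratio G v)"

definition grid_sequence :: "real \<Rightarrow> nat \<Rightarrow> (int \<times> int) pair_pre_digraph" where
  "grid_sequence c n = square_grid \<lceil>c * real n\<rceil>"

lemma pair_graph_square_grid: "pair_graph (square_grid a)"
proof
  have "parcs (square_grid a) \<subseteq> pverts (square_grid a) \<times> pverts (square_grid a)"
    by (auto simp: square_grid_def)
  moreover show fin: "finite (pverts (square_grid a))"
    by (simp add: square_grid_def)
  ultimately show "finite (parcs (square_grid a))"
    by (meson finite_SigmaI finite_subset)
  show "symmetric (with_proj (square_grid a))"
    by (auto simp: symmetric_def sym_def square_grid_def abs_minus_commute)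
qed (auto simp: square_grid_def)

lemma induced_subgraph_square_grid:
  assumes "a \<le> b"
  shows "induced_subgraph (with_proj (square_grid a)) (with_proj (square_grid b))"
proof -
  interpret A: pair_graph "square_grid a" by (rule pair_graph_square_grid)
  interpret B: pair_graph "square_grid b" by (rule pair_graph_square_grid)
  have "subgraph (with_proj (square_grid a)) (with_proj (square_grid b))"
    unfolding subgraph_def compatible_def
    using assms A.wf_digraph B.wf_digraph by (auto simp: square_grid_def)
  then show ?thesis
    using assms by (auto simp: induced_subgraph_def square_grid_def arcs_ends_conv)
qed

lemma growing_graphs_grid_sequence:
  assumes "0 \<le> c"
  shows "growing_graphs (grid_sequence c)"
proof -
  have "\<lceil>c * real n\<rceil> \<le> \<lceil>c * real (Suc n)\<rceil>" for n
    using assms by (intro ceiling_mono mult_left_mono) auto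
  then show ?thesis
    by (simp add: growing_graphs_def grid_sequence_def pair_graph_square_grid
        induced_subgraph_square_grid)
qed

end

theory Submission
  imports Defs "HOL-Library.Countable_Set" "HOL-Computational_Algebra.Nth_Powers"
    "HOL-Real_Asymp.Real_Asymp"
begin

text \<open>
  Since \<open>c \<ge> 1\<close>, the grid expands at least as fast as the fire, so a vertex activated at time \<open>s\<close>
  has burned its whole \<open>L\<^sub>1\<close>-ball of radius \<open>n - s\<close> at time \<open>n\<close>. Place activations in phases:
  starting at time \<open>k^4\<close>, activate the points with both coordinates divisible by \<open>k^3\<close> of the grid
  at that time. There are only \<open>O(k^2)\<close> of them, so this takes at most \<open>k^3\<close> steps once \<open>k\<close> is
  large, and after \<open>2 k^3\<close> further steps the balls cover the grid of time \<open>k^4\<close>. All this happens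
  before time \<open>(k+1)^4\<close>, so at every time between \<open>(k+1)^4\<close> and \<open>(k+2)^4\<close> the grid of time \<open>k^4\<close>
  is burned, and the ratio of the areas of these grids tends to \<open>1\<close>.
\<close>

section \<open>Sizes of the grids\<close>

lemma pverts_grid_sequence:
  "pverts (grid_sequence c n) = {-\<lceil>c * real n\<rceil>..\<lceil>c * real n\<rceil>} \<times> {-\<lceil>c * real n\<rceil>..\<lceil>c * real n\<rceil>}"
  by (simp add: grid_sequence_def square_grid_def)

lemma ceiling_mult_nonneg:
  fixes c :: real
  assumes "0 \<le> c"
  shows "0 \<le> \<lceil>c * real n\<rceil>"
proof -
  have "0 \<le> c * real n"
    using assms by simp
  then show ?thesis
    by linarith
qed

lemma card_pverts_grid_sequence:
  assumes "0 \<le> c"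
  shows "real (card (pverts (grid_sequence c n))) = (2 * of_int \<lceil>c * real n\<rceil> + 1)\<^sup>2"
proof -
  have "0 \<le> \<lceil>c * real n\<rceil>"
    using assms by (rule ceiling_mult_nonneg)
  then show ?thesis
    by (simp add: pverts_grid_sequence card_cartesian_product power2_eq_square)
qed

lemma card_pverts_grid_sequence_pos: "0 \<le> c \<Longrightarrow> 0 < card (pverts (grid_sequence c n))"
  unfolding card_gt_0_iff pverts_grid_sequence using ceiling_mult_nonneg[of c n] by auto

section \<open>Burning sets and the ball burned by a single activation\<close>

lemma burning_set_mono_Suc: "burning_set G v n \<subseteq> burning_set G v (Suc n)"
  by (auto simp: closed_nbhd_def split: option.splits)

lemma burning_set_mono: "m \<le> n \<Longrightarrow> burning_set G v m \<subseteq> burning_set G v n"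
  by (rule lift_Suc_mono_le[of "burning_set G v"]) (rule burning_set_mono_Suc)

text \<open>Arcs end in the current graph, and earlier graphs are contained in it. This supplies
  both the upper bound 1 on the ratio and the finiteness of burning sets.\<close>

lemma burning_set_subset_pverts:
  assumes "growing_graphs G" "activation_sequence G v"
  shows "burning_set G v n \<subseteq> pverts (G n)"
proof (induction n)
  case 0
  then show ?case
    using assms(2) by (auto simp: activation_sequence_def split: option.splits)
next
  case (Suc n)
  interpret pair_graph "G (Suc n)"
    using assms(1) by (simp add: growing_graphs_def)
  have "pverts (G n) \<subseteq> pverts (G (Suc n))"
    using assms(1) by (auto simp: growing_graphs_def induced_subgraph_def subgraph_def)
  with Suc have "closed_nbhd (G (Suc n)) (burning_set G v n) \<subseteq> pverts (G (Suc n))"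
    by (auto simp: closed_nbhd_def arcs_ends_conv dest: in_arcsD2)
  then show ?case
    using assms(2) by (auto simp: activation_sequence_def split: option.splits)
qed

text \<open>This is where \<open>c \<ge> 1\<close> matters: the half side grows by at least one per
  step, so the boundary never stops a fire of unit speed.\<close>

lemma ceiling_mult_add_le:
  fixes c :: real
  assumes "c \<ge> 1"
  shows "\<lceil>c * real s\<rceil> + int k \<le> \<lceil>c * real (s + k)\<rceil>"
proof -
  have "real k \<le> c * real k"
    using assms by (simp add: mult_le_cancel_right1)
  then have "\<lceil>c * real s + real_of_int (int k)\<rceil> \<le> \<lceil>c * real (s + k)\<rceil>"
    by (intro ceiling_mono) (simp add: algebra_simps)
  then show ?thesis
    by (simp only: ceiling_add_of_int)
qed

lemma ball_subset_burning_set: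
  assumes "c \<ge> 1" "activation_sequence (grid_sequence c) v" "v s = Some x"
    and "\<bar>fst x - fst y\<bar> + \<bar>snd x - snd y\<bar> \<le> int k"
  shows "y \<in> burning_set (grid_sequence c) v (s + k)"
  using assms(4)
proof (induction k arbitrary: y)
  case 0
  then have "y = x"
    by (auto simp: prod_eq_iff)
  then show ?case
    using assms(3) by (cases s) auto
next
  case (Suc k)
  show ?case
  proof (cases "\<bar>fst x - fst y\<bar> + \<bar>snd x - snd y\<bar> \<le> int k")
    case True
    then show ?thesis
      using Suc.IH burning_set_mono_Suc by fastforce
  next
    case False
    \<comment> \<open>\<open>z\<close> is one step from \<open>y\<close> towards \<open>x\<close>,
      in the first coordinate unless that already agrees; the second then differs, since the
      distance is exactly \<open>Suc k\<close>.\<close>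
    define z where "z = (if fst x = fst y then (fst y, snd y + sgn (snd x - snd y))
      else (fst y + sgn (fst x - fst y), snd y))"
    have z: "\<bar>fst x - fst z\<bar> + \<bar>snd x - snd z\<bar> \<le> int k"
      "\<bar>fst z - fst y\<bar> + \<bar>snd z - snd y\<bar> = 1"
      using Suc.prems False by (auto simp: z_def sgn_if)
    define A where "A = \<lceil>c * real (s + Suc k)\<rceil>"
    have "x \<in> pverts (grid_sequence c s)"
      using assms(2,3) unfolding activation_sequence_def by blast
    then have "\<bar>fst x\<bar> \<le> \<lceil>c * real s\<rceil>" "\<bar>snd x\<bar> \<le> \<lceil>c * real s\<rceil>"
      by (auto simp: pverts_grid_sequence)
    \<comment> \<open>Both points are within \<open>Suc k\<close> of \<open>x\<close>, which lies in
      the square of time \<open>s\<close>; the square has gained at least that much since.\<close>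
    moreover have "\<lceil>c * real s\<rceil> + int (Suc k) \<le> A"
      unfolding A_def by (rule ceiling_mult_add_le) fact
    ultimately have "y \<in> {-A..A} \<times> {-A..A}" "z \<in> {-A..A} \<times> {-A..A}"
      using Suc.prems z(1) by (auto simp: mem_Times_iff)
    then have "(z, y) \<in> parcs (grid_sequence c (s + Suc k))"
      using z(2) by (auto simp: grid_sequence_def square_grid_def A_def)
    then have "z \<rightarrow>\<^bsub>with_proj (grid_sequence c (s + Suc k))\<^esub> y"
      by (auto simp: arcs_ends_conv)
    moreover have "z \<in> burning_set (grid_sequence c) v (s + k)"
      using Suc.IH z(1) by blast
    ultimately show ?thesis
      by (auto simp: closed_nbhd_def split: option.splits)
  qed
qed

section \<open>A lattice that covers a square\<close>

definition lattice_points :: "int \<Rightarrow> int \<Rightarrow> (int \<times> int) set" where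
  "lattice_points L A = (\<lambda>(i, j). (L * i, L * j)) ` ({-(A div L)..A div L} \<times> {-(A div L)..A div L})"

lemma finite_lattice_points: "finite (lattice_points L A)"
  by (simp add: lattice_points_def)

text \<open>\<open>L = 0\<close> is included because phase 0 has spacing 0; as
  \<open>A div 0 = 0\<close>, the lattice is then just the origin.\<close>

lemma lattice_points_nonempty: "0 \<le> A \<Longrightarrow> 0 \<le> L \<Longrightarrow> lattice_points L A \<noteq> {}"
  by (simp add: lattice_points_def div_int_pos_iff)

lemma card_lattice_points_le:
  assumes "0 \<le> A" "0 \<le> L"
  shows "real (card (lattice_points L A)) \<le> (2 * of_int (A div L) + 1)\<^sup>2"
proof -
  have "card (lattice_points L A) \<le> card ({-(A div L)..A div L} \<times> {-(A div L)..A div L})"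
    unfolding lattice_points_def by (rule card_image_le) simp
  moreover have "0 \<le> A div L"
    using assms by (simp add: div_int_pos_iff)
  then have "real (card ({-(A div L)..A div L} \<times> {-(A div L)..A div L})) = (2 * of_int (A div L) + 1)\<^sup>2"
    by (simp add: card_cartesian_product power2_eq_square)
  ultimately show ?thesis
    by (metis of_nat_mono)
qed

lemma lattice_points_subset:
  assumes "0 \<le> A" "0 \<le> L"
  shows "lattice_points L A \<subseteq> {-A..A} \<times> {-A..A}"
proof -
  have "L * i \<in> {-A..A}" if "i \<in> {-(A div L)..A div L}" for i
  proof -
    have "\<bar>L * i\<bar> \<le> L * (A div L)"
      using that assms by (auto simp: abs_mult intro!: mult_left_mono)
    also have "\<dots> \<le> A"
      using assms mult_div_mod_eq[of L A] pos_mod_sign[of L A] by (cases "0 < L") (linarith, auto)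
    finally show ?thesis
      by auto
  qed
  then show ?thesis
    by (auto simp: lattice_points_def simp del: atLeastAtMost_iff)
qed

lemma multiple_near:
  fixes x A L :: int
  assumes "0 < L" "\<bar>x\<bar> \<le> A"
  shows "\<exists>i\<in>{-(A div L)..A div L}. \<bar>L * i - x\<bar> \<le> L"
proof -
  \<comment> \<open>Rounding goes towards zero: for negative \<open>x\<close>, plain
    \<open>div\<close> rounds away from zero and could leave the index range.\<close>
  define i where "i = sgn x * (\<bar>x\<bar> div L)"
  have "\<bar>x\<bar> div L \<le> A div L" "0 \<le> \<bar>x\<bar> div L"
    using assms by (auto intro: zdiv_mono1 simp: div_int_pos_iff)
  moreover have "\<bar>L * (\<bar>x\<bar> div L) - \<bar>x\<bar>\<bar> \<le> L"
    using assms pos_mod_bound[of L "\<bar>x\<bar>"] pos_mod_sign[of L "\<bar>x\<bar>"]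
      mult_div_mod_eq[of L "\<bar>x\<bar>"] by linarith
  ultimately show ?thesis
    by (intro bexI[of _ i]) (auto simp: i_def sgn_if abs_if split: if_splits)
qed

lemma lattice_point_near:
  assumes "0 < L" "y \<in> {-A..A} \<times> {-A..A}"
  obtains p where "p \<in> lattice_points L A" "\<bar>fst p - fst y\<bar> + \<bar>snd p - snd y\<bar> \<le> 2 * L"
proof -
  obtain i j where "i \<in> {-(A div L)..A div L}" "\<bar>L * i - fst y\<bar> \<le> L"
    "j \<in> {-(A div L)..A div L}" "\<bar>L * j - snd y\<bar> \<le> L"
    using multiple_near[of L "fst y" A] multiple_near[of L "snd y" A] assms
    by (auto simp: mem_Times_iff abs_le_iff)
  then show ?thesis
    by (intro that[of "(L * i, L * j)"]) (auto simp: lattice_points_def)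
qed

section \<open>The phased activation sequence\<close>

definition phase_points :: "real \<Rightarrow> nat \<Rightarrow> (int \<times> int) set" where
  "phase_points c k = lattice_points (int k ^ 3) \<lceil>c * real (k ^ 4)\<rceil>"

text \<open>The root is the \<open>k\<close> with \<open>k ^ 4 \<le> n < Suc k ^ 4\<close>, and
  \<open>n - k ^ 4\<close> is the position within phase \<open>k\<close>. Once this exceeds the
  number of points, \<open>from_nat_into\<close> returns a default element of the nonempty set,
  which has already been activated, so every step can use \<open>Some\<close>.\<close>

definition phased_activation :: "real \<Rightarrow> nat \<Rightarrow> (int \<times> int) option" where
  "phased_activation c n =
    (let k = nth_root_nat 4 n in Some (from_nat_into (phase_points c k) (n - k ^ 4)))"

lemma phase_points_subset:
  assumes "0 \<le> c" "k ^ 4 \<le> n"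
  shows "phase_points c k \<subseteq> pverts (grid_sequence c n)"
proof -
  have "\<lceil>c * real (k ^ 4)\<rceil> \<le> \<lceil>c * real n\<rceil>"
    using assms by (intro ceiling_mono mult_left_mono of_nat_mono)
  then show ?thesis
    using lattice_points_subset[of "\<lceil>c * real (k ^ 4)\<rceil>" "int k ^ 3"] ceiling_mult_nonneg[OF assms(1), of "k ^ 4"]
    unfolding phase_points_def pverts_grid_sequence by fastforce
qed

lemma activation_sequence_phased_activation:
  assumes "0 \<le> c"
  shows "activation_sequence (grid_sequence c) (phased_activation c)"
proof -
  have "from_nat_into (phase_points c (nth_root_nat 4 n)) m \<in> pverts (grid_sequence c n)" for n m
  proof -
    have "phase_points c (nth_root_nat 4 n) \<noteq> {}"
      unfolding phase_points_def
      by (intro lattice_points_nonempty ceiling_mult_nonneg assms) simp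
    moreover have "nth_root_nat 4 n ^ 4 \<le> n"
      by (rule nth_root_nat_power_le) simp
    ultimately show ?thesis
      using subsetD[OF phase_points_subset[OF assms] Countable_Set.from_nat_into] by simp
  qed
  then show ?thesis
    by (auto simp: activation_sequence_def phased_activation_def Let_def)
qed

lemma eventually_card_phase_points_le:
  assumes "0 < c"
  shows "eventually (\<lambda>k. card (phase_points c k) \<le> k ^ 3) sequentially"
proof -
  \<comment> \<open>The index range of the lattice reaches at most \<open>c * real k + 1\<close>,
    where the 1 absorbs the rounding error of the ceiling divided by \<open>k ^ 3\<close>. A
    quadratic in \<open>k\<close> is eventually below the cube, whatever \<open>c\<close>
    is.\<close>
  have "eventually (\<lambda>k. (2 * (c * real k + 1) + 1)\<^sup>2 \<le> real k ^ 3) sequentially"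
    using assms by real_asymp
  then show ?thesis
    using eventually_gt_at_top[of 0]
  proof eventually_elim
    case (elim k)
    define A where "A = \<lceil>c * real (k ^ 4)\<rceil>"
    have A: "0 \<le> A"
      unfolding A_def using assms by (intro ceiling_mult_nonneg) simp
    have "real_of_int (A div int k ^ 3) \<le> of_int A / real k ^ 3"
      using real_of_int_div4[of A "int k ^ 3"] by simp
    also have "\<dots> \<le> (c * real k ^ 4 + 1) / real k ^ 3"
      using of_int_ceiling_le_add_one[of "c * real (k ^ 4)"]
      by (intro divide_right_mono) (auto simp: A_def)
    also have "\<dots> = c * real k + 1 / real k ^ 3"
      using elim by (simp add: field_simps power_numeral_reduce)
    also have "\<dots> \<le> c * real k + 1"
      using elim by simp
    finally have le: "real_of_int (A div int k ^ 3) \<le> c * real k + 1" .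
    have "real (card (phase_points c k)) \<le> (2 * of_int (A div int k ^ 3) + 1)\<^sup>2"
      unfolding phase_points_def A_def[symmetric] by (rule card_lattice_points_le) (use A in auto)
    also have "\<dots> \<le> (2 * (c * real k + 1) + 1)\<^sup>2"
      using le A by (intro power_mono) (auto simp: div_int_pos_iff)
    also have "\<dots> \<le> real k ^ 3"
      by fact
    finally show ?case
      by (simp flip: of_nat_power)
  qed
qed

lemma pverts_subset_burning_set:
  assumes "c \<ge> 1" "0 < k" "card (phase_points c k) \<le> k ^ 3" "Suc k ^ 4 \<le> n"
  shows "pverts (grid_sequence c (k ^ 4)) \<subseteq> burning_set (grid_sequence c) (phased_activation c) n"
proof
  fix y assume "y \<in> pverts (grid_sequence c (k ^ 4))"
  then obtain p where p: "p \<in> phase_points c k"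
    "\<bar>fst p - fst y\<bar> + \<bar>snd p - snd y\<bar> \<le> 2 * int k ^ 3"
    using lattice_point_near[of "int k ^ 3" y "\<lceil>c * real (k ^ 4)\<rceil>"] assms(2)
    unfolding phase_points_def pverts_grid_sequence by auto
  have "bij_betw (from_nat_into (phase_points c k)) {..<card (phase_points c k)} (phase_points c k)"
    by (rule bij_betw_from_nat_into_finite) (simp add: phase_points_def finite_lattice_points)
  with p(1) obtain m where m: "m < card (phase_points c k)" "from_nat_into (phase_points c k) m = p"
    unfolding bij_betw_def by (metis imageE lessThan_iff)
  \<comment> \<open>The budget of \<open>3 * k ^ 3\<close> steps consists of \<open>k ^ 3\<close>
    for the activations and \<open>2 * k ^ 3\<close> for the radius; it fits because consecutive
    fourth powers differ by more than \<open>4 * k ^ 3\<close>.\<close>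
  have Suc: "k ^ 4 + 3 * k ^ 3 < Suc k ^ 4"
    by (simp add: eval_nat_numeral algebra_simps)
  have "nth_root_nat 4 (k ^ 4 + m) = k"
    by (rule nth_root_nat_unique) (use m(1) assms(3) Suc in auto)
  then have "phased_activation c (k ^ 4 + m) = Some p"
    by (simp add: phased_activation_def m(2))
  with p(2) have "y \<in> burning_set (grid_sequence c) (phased_activation c) (k ^ 4 + m + 2 * k ^ 3)"
    using assms(1) by (intro ball_subset_burning_set activation_sequence_phased_activation) auto
  moreover have "k ^ 4 + m + 2 * k ^ 3 \<le> n"
    using m(1) assms(3,4) Suc by linarith
  ultimately show "y \<in> burning_set (grid_sequence c) (phased_activation c) n"
    by (rule subsetD[OF burning_set_mono, rotated])
qed

section \<open>The lower bound on the ratio and its limit\<close>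

lemma filterlim_nth_root_nat:
  assumes "k > 0"
  shows "filterlim (nth_root_nat k) at_top at_top"
  unfolding filterlim_at_top eventually_at_top_linorder
proof (intro allI exI impI)
  fix m n :: nat assume "m ^ k \<le> n"
  then have "nth_root_nat k (m ^ k) \<le> nth_root_nat k n"
    by (rule nth_root_nat_mono)
  then show "m \<le> nth_root_nat k n"
    using assms by simp
qed

text \<open>With \<open>r\<close> the integer fourth root of \<open>n\<close>, phase
  \<open>r - 1\<close> is complete by time \<open>r ^ 4 \<le> n\<close>, while
  \<open>n < Suc r ^ 4\<close> bounds the whole grid. The ceiling adds at most 1 to the half side,
  hence the constant 3 in the denominator.\<close>

lemma eventually_burning_ratio_ge:
  assumes "c \<ge> 1"
  shows "eventually (\<lambda>n. ((2 * c * real (nth_root_nat 4 n - 1) ^ 4 + 1) /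
      (2 * c * real (nth_root_nat 4 n + 1) ^ 4 + 3))\<^sup>2
    \<le> burning_ratio (grid_sequence c) (phased_activation c) n) sequentially"
proof -
  \<comment> \<open>\<open>1 < r\<close> makes the completed phase \<open>r - 1\<close> positive, so
    its lattice spacing is nonzero.\<close>
  have "eventually (\<lambda>r. 1 < r \<and> card (phase_points c (r - 1)) \<le> (r - 1) ^ 3) sequentially"
    using eventually_gt_at_top[of 1]
      filterlim_iff[THEN iffD1, OF filterlim_minus_const_nat_at_top, rule_format,
        OF eventually_card_phase_points_le[of c]] assms by (auto intro: eventually_conj)
  from this filterlim_nth_root_nat[of 4]
  have "eventually (\<lambda>n. 1 < nth_root_nat 4 n \<and>
      card (phase_points c (nth_root_nat 4 n - 1)) \<le> (nth_root_nat 4 n - 1) ^ 3) sequentially"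
    by (rule eventually_compose_filterlim) simp
  then show ?thesis
  proof eventually_elim
    case (elim n)
    define r where "r = nth_root_nat 4 n"
    define B where "B = burning_set (grid_sequence c) (phased_activation c) n"
    have r: "r ^ 4 \<le> n" "n < Suc r ^ 4"
      unfolding r_def using nth_root_nat_power_le[of 4 n] nth_root_nat_ge[of 4 "Suc (nth_root_nat 4 n)" n]
      not_le by auto
    have pos: "real (card (pverts (grid_sequence c n))) > 0"
      using assms card_pverts_grid_sequence_pos[of c n] by simp
    have "pverts (grid_sequence c ((r - 1) ^ 4)) \<subseteq> B"
      unfolding B_def by (rule pverts_subset_burning_set) (use assms elim r in \<open>auto simp: r_def\<close>)
    moreover have "finite B"
      unfolding B_def using assms
      by (intro finite_subset[OF burning_set_subset_pverts] growing_graphs_grid_sequence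
          activation_sequence_phased_activation) (auto simp: pverts_grid_sequence)
    ultimately have "real (card (pverts (grid_sequence c ((r - 1) ^ 4)))) \<le> card B"
      by (simp add: card_mono)
    moreover have "(2 * c * real (r - 1) ^ 4 + 1)\<^sup>2 \<le> real (card (pverts (grid_sequence c ((r - 1) ^ 4))))"
    proof -
      have "c * real (r - 1) ^ 4 \<le> of_int \<lceil>c * real ((r - 1) ^ 4)\<rceil>"
        using le_of_int_ceiling[of "c * real ((r - 1) ^ 4)"] by simp
      then show ?thesis
        using assms by (subst card_pverts_grid_sequence) (auto intro!: power_mono)
    qed
    moreover have "real (card (pverts (grid_sequence c n))) \<le> (2 * c * real (r + 1) ^ 4 + 3)\<^sup>2"
    proof -
      have "real n \<le> real (r + 1) ^ 4"
        using r(2) by (metis Suc_eq_plus1 less_imp_le of_nat_le_iff of_nat_power)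
      then have "c * real n \<le> c * real (r + 1) ^ 4"
        using assms by (intro mult_left_mono) auto
      then have "real_of_int \<lceil>c * real n\<rceil> \<le> c * real (r + 1) ^ 4 + 1"
        using of_int_ceiling_le_add_one[of "c * real n"] by linarith
      then show ?thesis
        using assms ceiling_mult_nonneg[of c n]
        by (subst card_pverts_grid_sequence) (auto intro!: power_mono)
    qed
    ultimately show ?case
      using pos unfolding burning_ratio_def r_def[symmetric] B_def[symmetric] power_divide
      by (intro frac_le) auto
  qed
qed

theorem theorem9:
  fixes c :: real
  assumes "c \<ge> 1"
  shows "\<exists>v. activation_sequence (grid_sequence c) v
    \<and> burning_density_exists (grid_sequence c) v
    \<and> burning_density (grid_sequence c) v = 1"
proof -
  have act: "activation_sequence (grid_sequence c) (phased_activation c)"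
    using assms by (intro activation_sequence_phased_activation) auto
  have "(\<lambda>r. ((2 * c * (real r - 1) ^ 4 + 1) / (2 * c * (real r + 1) ^ 4 + 3))\<^sup>2)
      \<longlonglongrightarrow> 1"
    using assms by real_asymp
  \<comment> \<open>Truncated subtraction agrees with real subtraction for \<open>r > 0\<close>, so
    the limit carries over.\<close>
  then have "(\<lambda>r. ((2 * c * real (r - 1) ^ 4 + 1) / (2 * c * real (r + 1) ^ 4 + 3))\<^sup>2)
      \<longlonglongrightarrow> 1"
    by (rule Lim_transform_eventually)
      (use eventually_gt_at_top[of 0] in eventually_elim, simp add: of_nat_diff add.commute)
  from filterlim_compose[OF this filterlim_nth_root_nat]
  have lower: "(\<lambda>n. ((2 * c * real (nth_root_nat 4 n - 1) ^ 4 + 1) /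
      (2 * c * real (nth_root_nat 4 n + 1) ^ 4 + 3))\<^sup>2) \<longlonglongrightarrow> 1"
    by simp
  have upper: "burning_ratio (grid_sequence c) (phased_activation c) n \<le> 1" for n
  proof -
    have "burning_set (grid_sequence c) (phased_activation c) n \<subseteq> pverts (grid_sequence c n)"
      using assms act by (intro burning_set_subset_pverts growing_graphs_grid_sequence) auto
    then show ?thesis
      unfolding burning_ratio_def
      using assms card_pverts_grid_sequence_pos[of c n]
      by (subst divide_le_eq_1_pos) (auto intro!: card_mono dest: card_ge_0_finite)
  qed
  have "burning_ratio (grid_sequence c) (phased_activation c) \<longlonglongrightarrow> 1"
    by (rule tendsto_sandwich[OF eventually_burning_ratio_ge[OF assms] _ lower tendsto_const])
      (simp add: upper)
  then have "burning_density_exists (grid_sequence c) (phased_activation c)"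
    "burning_density (grid_sequence c) (phased_activation c) = 1"
    by (auto simp: burning_density_exists_def burning_density_def intro: convergentI limI)
  with act show ?thesis
    by blast
qed

end
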